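(* Let $m,n,k\ge 1$ be integers, let $A\in\mathbb{Z}^{m\times n}$ and $b\in\mathbb{Z}^m$ satisfy $A_{ij}\ge 0$ and $b_i>0$ for all $i=1,\ldots,m$, $j=1,\ldots,n$, and let $Q=\{x\in\mathbb{R}^n : x\ge 0,\ Ax\le b\}$. Then the $k$-aggregation closure $$\mathcal{A}_k(Q)=\bigcap_{\Lambda\in\mathbb{R}^{m\times k}_+}\operatorname{conv}\{Q^\Lambda\cap\mathbb{Z}^n\},\qquad Q^\Lambda=\{x\in\mathbb{R}^n : x\ge 0,\ \Lambda^TAx\le\Lambda^Tb\},$$ is a polyhedron.
   Context: $\mathbb{R}^{m\times k}_+$ denotes the set of real $m\times k$ matrices with nonnegative entries (not necessarily rational); inequalities between vectors are componentwise; $\operatorname{conv}$ denotes convex hull. A polyhedron is an intersection of finitely many closed halfspaces of $\mathbb{R}^n$. A packing integer program is one with feasible region $\{x\in\mathbb{Z}^n : x\ge0,\ Ax\le b\}$ with $A,b$ as in the claim. *)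

theory Defs
  imports "HOL-Analysis.Analysis"
begin

text \<open>
  Vectors are indexed by finite types. A matrix with rows \<open>'m\<close> and columns \<open>'n\<close> has type
  \<open>real^'n^'m\<close>, and \<open>\<le>\<close> on \<open>real^'n\<close> is the componentwise order. Index types are nonempty,
  so all dimensions are at least 1.
\<close>

definition integer_vectors :: "(real^'n) set" where
  "integer_vectors = {x. \<forall>j. x $ j \<in> \<int>}"

definition packing_polyhedron :: "real^'n^'m \<Rightarrow> real^'m \<Rightarrow> (real^'n) set" where
  "packing_polyhedron A b = {x. 0 \<le> x \<and> A *v x \<le> b}"

definition aggregated_polyhedron ::
  "real^'k^'m \<Rightarrow> real^'n^'m \<Rightarrow> real^'m \<Rightarrow> (real^'n) set" where
  "aggregated_polyhedron \<Lambda> A b = packing_polyhedron (transpose \<Lambda> ** A) (transpose \<Lambda> *v b)"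

text \<open>
  The number \<open>k\<close> of aggregated constraints is the cardinality of the index type \<open>'k\<close>, which is
  passed as a type token. The closure is a function of the description \<open>(A, b)\<close> of the
  polyhedron \<open>packing_polyhedron A b\<close>. The multipliers \<open>\<Lambda>\<close> are arbitrary nonnegative reals, so
  the intersection is over an infinite family.
\<close>

definition aggregation_closure ::
  "'k::finite itself \<Rightarrow> real^'n^'m \<Rightarrow> real^'m \<Rightarrow> (real^'n) set" where
  "aggregation_closure _ A b =
     (\<Inter>\<Lambda> \<in> {\<Lambda> :: real^'k^'m. \<forall>i l. 0 \<le> \<Lambda> $ i $ l}.
        convex hull (aggregated_polyhedron \<Lambda> A b \<inter> integer_vectors))"

end

theory Submission
  imports Defs
begin

text \<open>
  The integer points of \<open>Q\<^sup>\<Lambda>\<close> form a downward closed subset of \<open>\<nat>\<^sup>n\<close>. Coordinates belonging to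
  zero columns of \<open>\<Lambda>\<^sup>T A\<close> are free and the other ones are bounded, so this set is a cylinder over a
  finite set and its convex hull is a polyhedron. By Dickson's lemma and Higman's lemma for finite
  sets, the finite sections belonging to a given set of free coordinates are well-quasi-ordered by
  inclusion. Hence finitely many \<open>\<Lambda>\<close> already determine the intersection.
\<close>

section \<open>Well-quasi-orders: Dickson's lemma, domination of finite sets, finite bases\<close>

text \<open>Every sequence has a monotone subsequence. If that one decreases, it is constant once it
  attains its minimum, so a tail of it serves.\<close>

lemma nat_seq_mono_subseq:
  fixes g :: "nat \<Rightarrow> nat"
  obtains r :: "nat \<Rightarrow> nat" where "strict_mono r" "mono (g \<circ> r)"
proof -
  obtain s where s: "strict_mono s" "monoseq (\<lambda>n. g (s n))"
    using seq_monosub[of g] by blast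
  show thesis
  proof (cases "incseq (\<lambda>n. g (s n))")
    case True
    then show ?thesis using that[of s] s(1) by (simp add: o_def)
  next
    case False
    then have dec: "decseq (\<lambda>n. g (s n))"
      using s(2) by (simp add: monoseq_iff)
    obtain N where N: "\<And>n. g (s N) \<le> g (s n)"
      using ex_has_least_nat[of "\<lambda>_. True" _ "\<lambda>n. g (s n)"] by blast
    have const: "g (s (N + n)) = g (s N)" for n
      using N decseqD[OF dec, of N "N + n"] by (simp add: antisym)
    show ?thesis
    proof (rule that)
      show "strict_mono (\<lambda>n. s (N + n))"
        using s(1) by (simp add: strict_mono_def)
      show "mono (g \<circ> (\<lambda>n. s (N + n)))"
        by (simp add: mono_def const)
    qed
  qed
qed

text \<open>Subsequences are refined one coordinate at a time; coordinates treated earlier stay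
  monotone under further refinement.\<close>

theorem dickson_mono_subseq:
  fixes f :: "nat \<Rightarrow> real^'n"
  assumes "\<And>i c. f i $ c \<in> \<nat>"
  obtains r :: "nat \<Rightarrow> nat" where "strict_mono r" "mono (f \<circ> r)"
proof -
  have "\<exists>r::nat \<Rightarrow> nat. strict_mono r \<and> (\<forall>c\<in>C. mono (\<lambda>i. f (r i) $ c))" if "finite C" for C :: "'n set"
    using that
  proof induction
    case empty
    show ?case by (rule exI[of _ id]) (simp add: strict_mono_def)
  next
    case (insert c C)
    then obtain r :: "nat \<Rightarrow> nat" where r: "strict_mono r" "\<And>d. d \<in> C \<Longrightarrow> mono (\<lambda>i. f (r i) $ d)"
      by blast
    have "\<exists>m. f i $ c = real m" for i
      using assms[of i c] by (auto elim: Nats_cases)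
    then obtain g where g: "\<And>i. f i $ c = real (g i)"
      by metis
    obtain s :: "nat \<Rightarrow> nat" where s: "strict_mono s" "mono ((g \<circ> r) \<circ> s)"
      by (rule nat_seq_mono_subseq[of "g \<circ> r"])
    show ?case
    proof (intro exI conjI ballI)
      show "strict_mono (r \<circ> s)"
        using r(1) s(1) by (rule strict_mono_o)
      fix d assume "d \<in> insert c C"
      then show "mono (\<lambda>i. f ((r \<circ> s) i) $ d)"
        using r(2) s g strict_mono_mono[OF s(1)] by (fastforce simp: mono_def)
    qed
  qed
  from this[of UNIV] obtain r :: "nat \<Rightarrow> nat" where "strict_mono r" "\<And>c. mono (\<lambda>i. f (r i) $ c)"
    by auto
  then show thesis
    by (intro that) (auto simp: mono_def less_eq_vec_def)
qed

text \<open>Nash-Williams' minimal bad sequence argument, with minimality measured by cardinality.\<close>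

theorem finite_sets_domination_good:
  fixes F :: "nat \<Rightarrow> 'a::order set"
  assumes sub: "\<And>f::nat \<Rightarrow> 'a. range f \<subseteq> S \<Longrightarrow> \<exists>r::nat \<Rightarrow> nat. strict_mono r \<and> mono (f \<circ> r)"
    and F: "\<And>i. finite (F i)" "\<And>i. F i \<subseteq> S"
  shows "\<exists>i j. i < j \<and> (\<forall>x\<in>F i. \<exists>y\<in>F j. x \<le> y)"
proof (rule ccontr)
  assume F_bad: "\<not> ?thesis"
  define dom :: "'a set \<Rightarrow> 'a set \<Rightarrow> bool" where "dom X Y \<longleftrightarrow> (\<forall>x\<in>X. \<exists>y\<in>Y. x \<le> y)" for X Y
  define bad where "bad G \<longleftrightarrow> (\<forall>i. finite (G i) \<and> G i \<subseteq> S) \<and> (\<forall>i j. i < j \<longrightarrow> \<not> dom (G i) (G j))"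
    for G :: "nat \<Rightarrow> 'a set"
  define minimal where "minimal n G \<longleftrightarrow>
      bad G \<and> (\<forall>H. bad H \<longrightarrow> (\<forall>i<n. H i = G i) \<longrightarrow> card (G n) \<le> card (H n))"
    for n and G :: "nat \<Rightarrow> 'a set"
  have minimize: "\<exists>H. minimal n H \<and> (\<forall>i<n. H i = G i)" if "bad G" for n G
  proof -
    let ?P = "\<lambda>H. bad H \<and> (\<forall>i<n. H i = G i)"
    have "?P G" using that by simp
    from ex_has_least_nat[of ?P, OF this, of "\<lambda>H. card (H n)"]
    obtain H where H: "?P H" "\<And>H'. ?P H' \<Longrightarrow> card (H n) \<le> card (H' n)"
      by blast
    show ?thesis
      using H by (intro exI[of _ H]) (auto simp: minimal_def)
  qed
  have "bad F"
    using F F_bad by (auto simp: bad_def dom_def)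
  \<comment> \<open>Each stage freezes the sets with index at most \<open>n\<close> and then
    minimises the cardinality of the next one among all bad continuations.\<close>
  have "\<exists>H. \<forall>n. minimal n (H n) \<and> (\<forall>i<Suc n. H (Suc n) i = H n i)"
  proof (rule dependent_nat_choice)
    show "\<exists>G. minimal 0 G"
      using minimize[OF \<open>bad F\<close>] by blast
  next
    fix G n assume "minimal n G"
    then show "\<exists>H. minimal (Suc n) H \<and> (\<forall>i<Suc n. H i = G i)"
      using minimize[of G "Suc n"] by (simp add: minimal_def)
  qed
  then obtain H where H: "\<And>n. minimal n (H n)" "\<And>n i. i \<le> n \<Longrightarrow> H (Suc n) i = H n i"
    by (auto simp: less_Suc_eq_le)
  \<comment> \<open>The diagonal agrees with \<open>H n\<close> up to index \<open>n\<close>, so it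
    inherits badness and minimality at every index.\<close>
  define M where "M n = H n n" for n
  have HM: "H n i = M i" if "i \<le> n" for n i
    using that by (induction n rule: dec_induct) (simp_all add: M_def H(2))
  have badM: "bad M"
    unfolding bad_def
  proof (intro conjI allI impI)
    show "finite (M i)" "M i \<subseteq> S" for i
      using H(1)[of i] by (auto simp: M_def minimal_def bad_def)
    show "\<not> dom (M i) (M j)" if "i < j" for i j
    proof -
      have "bad (H j)"
        using H(1) by (simp add: minimal_def)
      then have "\<not> dom (H j i) (H j j)"
        using that by (simp add: bad_def)
      then show ?thesis
        using that HM by simp
    qed
  qed
  have minM: "card (M n) \<le> card (G n)" if "bad G" "\<And>i. i < n \<Longrightarrow> G i = M i" for G n
  proof -
    have "\<forall>i<n. G i = H n i"
      using that(2) HM by simp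
    then show ?thesis
      using H(1)[of n] that(1) by (simp add: minimal_def M_def)
  qed
  have ndom: "\<not> dom (M i) (M j)" if "i < j" for i j
    using badM that by (simp add: bad_def)
  have fin: "finite (M i)" and subS: "M i \<subseteq> S" for i
    using badM by (auto simp: bad_def)
  \<comment> \<open>The empty set is dominated by every set, so it cannot occur in a bad
    sequence.\<close>
  have "\<exists>x. x \<in> M i" for i
    using ndom[of i "Suc i"] by (auto simp: dom_def)
  then obtain a where a: "\<And>i. a i \<in> M i"
    by metis
  with subS have "range a \<subseteq> S"
    by blast
  then obtain r :: "nat \<Rightarrow> nat" where r: "strict_mono r" "mono (a \<circ> r)"
    using sub[of a] by blast
  \<comment> \<open>\<open>M\<close> is followed up to index \<open>r 0\<close>, then only along
    \<open>r\<close> with the chosen elements deleted. If \<open>G\<close> is bad, its set at index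
    \<open>r 0\<close> is one element smaller than \<open>M (r 0)\<close>, against
    minimality.\<close>
  define G where "G i = (if i < r 0 then M i else M (r (i - r 0)) - {a (r (i - r 0))})" for i
  have "\<not> dom (G i) (G j)" if "i < j" for i j
  proof
    assume d: "dom (G i) (G j)"
    consider "j < r 0" | "i < r 0" "r 0 \<le> j" | "r 0 \<le> i"
      by linarith
    then show False
    proof cases
      case 1
      with d that ndom[of i j] show False
        by (simp add: G_def)
    next
      case 2
      have "i < r (j - r 0)"
        using 2 strict_mono_leD[OF r(1), of 0 "j - r 0"] by simp
      moreover have "dom (M i) (M (r (j - r 0)))"
        using d 2 by (auto simp: G_def dom_def)
      ultimately show False
        using ndom by blast
    next
      case 3
      let ?i = "r (i - r 0)" and ?j = "r (j - r 0)"
      \<comment> \<open>The deleted element \<open>a ?i\<close> lies below \<open>a ?j\<close>, so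
        domination between the reduced sets extends to the full sets.\<close>
      have "a ?i \<le> a ?j"
        using r(2) 3 that by (simp add: mono_def diff_le_mono)
      moreover have "dom (M ?i - {a ?i}) (M ?j - {a ?j})"
        using d 3 that by (simp add: G_def)
      ultimately have "dom (M ?i) (M ?j)"
        using a[of ?j] unfolding dom_def by blast
      moreover have "?i < ?j"
        using r(1) 3 that by (simp add: strict_mono_less diff_less_mono)
      ultimately show False
        using ndom by blast
    qed
  qed
  then have "bad G"
    using fin subS by (auto simp: bad_def G_def intro: subsetD[OF subS])
  then have "card (M (r 0)) \<le> card (G (r 0))"
    by (rule minM) (simp add: G_def)
  moreover have "card (G (r 0)) < card (M (r 0))"
    using card_Diff1_less[OF fin a] by (simp add: G_def)
  ultimately show False
    by simp
qed

text \<open>Without a finite basis, the finitely many elements chosen so far always miss some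
  element of \<open>I\<close>; choosing such an element forever gives a sequence with no good
  pair.\<close>

lemma finite_basis_if_all_sequences_good:
  assumes good: "\<And>f :: nat \<Rightarrow> 'a. range f \<subseteq> I \<Longrightarrow> \<exists>i j. i < j \<and> R (f i) (f j)"
  shows "\<exists>M. finite M \<and> M \<subseteq> I \<and> (\<forall>x\<in>I. \<exists>y\<in>M. R y x)"
proof (rule ccontr)
  assume "\<not> ?thesis"
  then have step: "\<forall>M. finite M \<longrightarrow> M \<subseteq> I \<longrightarrow> (\<exists>x\<in>I. \<forall>y\<in>M. \<not> R y x)"
    by auto
  have "\<exists>f :: nat \<Rightarrow> 'a. \<forall>n. f n \<in> I \<and> (\<forall>m<n. \<not> R (f m) (f n))"
  proof (rule dependent_wellorder_choice[where P = "\<lambda>f n x. x \<in> I \<and> (\<forall>m<n. \<not> R (f m) x)"])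
    fix n :: nat and f :: "nat \<Rightarrow> 'a"
    assume "\<And>m. m < n \<Longrightarrow> f m \<in> I \<and> (\<forall>i<m. \<not> R (f i) (f m))"
    then show "\<exists>x. x \<in> I \<and> (\<forall>m<n. \<not> R (f m) x)"
      using step[rule_format, of "f ` {..<n}"] by (auto simp: image_subset_iff)
  qed simp
  then obtain f :: "nat \<Rightarrow> 'a" where f: "\<And>n. f n \<in> I" "\<And>m n. m < n \<Longrightarrow> \<not> R (f m) (f n)"
    by auto
  have "range f \<subseteq> I"
    using f(1) by auto
  from good[OF this] f(2) show False
    by auto
qed

section \<open>Coordinate projections, cylinders and their convex hulls\<close>

text \<open>Zeroing coordinates instead of dropping them keeps the projections for all
  \<open>J\<close> in one vector type.\<close>

definition restrict_coords :: "'n set \<Rightarrow> real^'n \<Rightarrow> real^'n" where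
  "restrict_coords J x = (\<chi> j. if j \<in> J then x $ j else 0)"

lemma restrict_coords_nth [simp]: "restrict_coords J x $ j = (if j \<in> J then x $ j else 0)"
  by (simp add: restrict_coords_def)

lemma linear_restrict_coords: "linear (restrict_coords J)"
  by (auto intro!: linearI simp: vec_eq_iff)

lemma inner_restrict_coords: "a \<bullet> restrict_coords J x = restrict_coords J a \<bullet> x"
  unfolding inner_vec_def by (intro sum.cong) auto

definition nonneg_integer_vectors :: "(real^'n) set" where
  "nonneg_integer_vectors = {x. 0 \<le> x} \<inter> integer_vectors"

lemma nonneg_integer_vectors_iff: "x \<in> nonneg_integer_vectors \<longleftrightarrow> (\<forall>j. x $ j \<in> \<nat>)"
  by (auto simp: nonneg_integer_vectors_def integer_vectors_def less_eq_vec_def Nats_altdef2)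

text \<open>The projection is self-adjoint, so pulling back a halfspace only restricts its normal.
  The normal may become zero; the preimage is then everything or empty, still a polyhedron.\<close>

lemma polyhedron_restrict_coords_vimage:
  assumes "polyhedron P"
  shows "polyhedron {x. restrict_coords J x \<in> P}"
proof -
  obtain \<H> where \<H>: "finite \<H>" "P = \<Inter>\<H>" 
      "\<forall>h\<in>\<H>. \<exists>a b. a \<noteq> 0 \<and> h = {x. a \<bullet> x \<le> b}"
    using assms unfolding polyhedron_def by auto
  have "{x. restrict_coords J x \<in> P} = (\<Inter>h\<in>\<H>. {x. restrict_coords J x \<in> h})"
    using \<H>(2) by auto
  moreover have "polyhedron {x. restrict_coords J x \<in> h}" if "h \<in> \<H>" for h
  proof -
    obtain a b where "h = {x. a \<bullet> x \<le> b}"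
      using \<H>(3) \<open>h \<in> \<H>\<close> by auto
    then show ?thesis
      by (simp add: inner_restrict_coords polyhedron_halfspace_le)
  qed
  ultimately show ?thesis
    using \<H>(1) by (auto intro!: polyhedron_Inter)
qed

lemma polyhedron_nonneg: "polyhedron {x :: real^'n. 0 \<le> x}"
proof -
  have "{x :: real^'n. 0 \<le> x} = (\<Inter>j\<in>UNIV. {x. axis j 1 \<bullet> x \<ge> 0})"
    by (auto simp: less_eq_vec_def inner_axis')
  moreover have "polyhedron (\<Inter>j\<in>UNIV. {x :: real^'n. axis j 1 \<bullet> x \<ge> 0})"
    by (intro polyhedron_Inter) (auto simp: polyhedron_halfspace_ge)
  ultimately show ?thesis
    by simp
qed

text \<open>Fractional coordinates are rounded one at a time: the vector lies on the segment between
  its two roundings in that coordinate.\<close>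

lemma nonneg_vector_in_convex_hull_integer:
  fixes x :: "real^'n"
  assumes "0 \<le> x" "\<And>j. j \<notin> J \<Longrightarrow> x $ j = 0"
  shows "x \<in> convex hull {z \<in> nonneg_integer_vectors. \<forall>j. j \<notin> J \<longrightarrow> z $ j = 0}"
    (is "_ \<in> convex hull ?Z")
proof -
  \<comment> \<open>The induction is on the set \<open>T\<close> of coordinates that may still be
    fractional.\<close>
  have "x \<in> convex hull ?Z"
    if "finite T" "0 \<le> x" "\<And>j. j \<notin> J \<Longrightarrow> x $ j = 0" "T \<subseteq> J" "\<And>j. j \<notin> T \<Longrightarrow> x $ j \<in> \<int>"
    for T and x :: "real^'n"
    using that
  proof (induction T arbitrary: x)
    case empty
    then have "x \<in> ?Z"
      by (auto simp: nonneg_integer_vectors_def integer_vectors_def)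
    then show ?case
      by (rule hull_inc)
  next
    case (insert t T)
    define y where "y s = (\<chi> j. if j = t then real_of_int \<lfloor>x $ t\<rfloor> + s else x $ j)" for s :: real
    have y: "y s \<in> convex hull ?Z" if "s \<in> {0, 1}" for s
    proof (rule insert.IH)
      have "0 \<le> x $ t"
        using insert.prems(1) by (simp add: less_eq_vec_def)
      then show "0 \<le> y s"
        using insert.prems(1) that by (auto simp: y_def less_eq_vec_def)
    qed (use insert.prems that in \<open>auto simp: y_def\<close>)
    have "x = (1 - frac (x $ t)) *\<^sub>R y 0 + frac (x $ t) *\<^sub>R y 1"
      by (auto simp: vec_eq_iff y_def frac_def algebra_simps)
    also have "\<dots> \<in> convex hull ?Z"
      using frac_lt_1[of "x $ t"] by (intro convexD convex_convex_hull y) auto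
    finally show ?case .
  qed
  from this[of J x] assms show ?thesis
    by simp
qed

text \<open>The cylinder contains the Minkowski sum of \<open>F\<close> and the nonnegative integer
  vectors supported off \<open>J\<close>. Convex hulls commute with Minkowski sums, and the second
  summand has the whole nonnegative orthant off \<open>J\<close> in its hull.\<close>

lemma convex_hull_cylinder:
  fixes F :: "(real^'n) set"
  assumes F: "F \<subseteq> nonneg_integer_vectors" "\<And>x. x \<in> F \<Longrightarrow> restrict_coords J x = x"
  shows "convex hull {x \<in> nonneg_integer_vectors. restrict_coords J x \<in> F} =
    {x. 0 \<le> x} \<inter> {x. restrict_coords J x \<in> convex hull F}" (is "convex hull ?D = ?R")
proof
  show "convex hull ?D \<subseteq> ?R"
  proof (rule hull_minimal)
    show "?D \<subseteq> ?R"
      by (auto simp: nonneg_integer_vectors_def hull_inc)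
    have "convex (restrict_coords J -` (convex hull F))"
      by (intro convex_linear_vimage linear_restrict_coords convex_convex_hull)
    then show "convex ?R"
      using polyhedron_imp_convex[OF polyhedron_nonneg] by (auto simp: vimage_def intro: convex_Int)
  qed
  show "?R \<subseteq> convex hull ?D"
  proof
    fix x assume x: "x \<in> ?R"
    let ?Z = "{z \<in> nonneg_integer_vectors. \<forall>j. j \<notin> - J \<longrightarrow> z $ j = 0} :: (real^'n) set"
    have "x = restrict_coords J x + restrict_coords (- J) x"
      by (simp add: vec_eq_iff)
    also have "\<dots> \<in> convex hull F + convex hull ?Z"
      using x by (intro set_plus_intro nonneg_vector_in_convex_hull_integer)
        (auto simp: less_eq_vec_def)
    also have "\<dots> = convex hull (F + ?Z)"
      by (simp add: convex_hull_set_plus)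
    also have "\<dots> \<subseteq> convex hull ?D"
    proof (rule hull_mono, rule subsetI)
      fix u assume "u \<in> F + ?Z"
      then obtain v z where u: "u = v + z" "v \<in> F" "z \<in> ?Z"
        by (auto elim: set_plus_elim)
      then have "restrict_coords J u = restrict_coords J v"
        by (auto simp: vec_eq_iff)
      moreover have "u \<in> nonneg_integer_vectors"
        using u F(1) by (auto simp: nonneg_integer_vectors_iff)
      ultimately show "u \<in> ?D"
        using F(2) u(2) by simp
    qed
    finally show "x \<in> convex hull ?D" .
  qed
qed

text \<open>
  For packing sets with the same bounded coordinates \<open>J\<close>, inclusion is domination of their finite
  \<open>J\<close>-sections, so only finitely many of them matter.
\<close>

lemma polyhedron_Inter_convex_hull_cylinders:
  fixes F :: "'i \<Rightarrow> (real^'n) set"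
  assumes fin: "\<And>i. i \<in> I \<Longrightarrow> finite (F i)"
    and int: "\<And>i. i \<in> I \<Longrightarrow> F i \<subseteq> nonneg_integer_vectors"
    and restr: "\<And>i x. i \<in> I \<Longrightarrow> x \<in> F i \<Longrightarrow> restrict_coords J x = x"
    and down: "\<And>i x y. i \<in> I \<Longrightarrow> y \<in> F i \<Longrightarrow> x \<in> nonneg_integer_vectors \<Longrightarrow> x \<le> y \<Longrightarrow> x \<in> F i"
  shows "polyhedron (\<Inter>i\<in>I. convex hull {x \<in> nonneg_integer_vectors. restrict_coords J x \<in> F i})"
proof -
  let ?D = "\<lambda>i. {x \<in> nonneg_integer_vectors. restrict_coords J x \<in> F i}"
  have good: "\<exists>i j. i < j \<and> F (f i) \<subseteq> F (f j)" if "range f \<subseteq> I" for f :: "nat \<Rightarrow> 'i"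
  proof -
    have f: "f i \<in> I" for i
      using that by auto
    have "\<exists>i j. i < j \<and> (\<forall>x\<in>F (f i). \<exists>y\<in>F (f j). x \<le> y)"
    proof (rule finite_sets_domination_good[where S = nonneg_integer_vectors])
      fix g :: "nat \<Rightarrow> real^'n"
      assume "range g \<subseteq> nonneg_integer_vectors"
      then have "g i $ c \<in> \<nat>" for i c
        using nonneg_integer_vectors_iff by blast
      then show "\<exists>r::nat \<Rightarrow> nat. strict_mono r \<and> mono (g \<circ> r)"
        by (metis dickson_mono_subseq)
    qed (use fin int f in auto)
    \<comment> \<open>Each point of \<open>F (f i)\<close> lies below a point of
      \<open>F (f j)\<close>, so downward closure turns domination into inclusion.\<close>
    then show ?thesis
      using int down f by (meson subset_iff)
  qed
  \<comment> \<open>Smaller sections give smaller hulls, so the hulls indexed by \<open>M\<close>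
    already determine the intersection.\<close>
  obtain M where M: "finite M" "M \<subseteq> I" "\<And>i. i \<in> I \<Longrightarrow> \<exists>j\<in>M. F j \<subseteq> F i"
    using finite_basis_if_all_sequences_good[of I "\<lambda>i j. F i \<subseteq> F j", OF good] by auto
  have "\<exists>j\<in>M. convex hull ?D j \<subseteq> convex hull ?D i" if "i \<in> I" for i
  proof -
    obtain j where "j \<in> M" "F j \<subseteq> F i"
      using M(3) \<open>i \<in> I\<close> by blast
    then show ?thesis
      by (intro bexI[of _ j] hull_mono) auto
  qed
  then have "(\<Inter>i\<in>I. convex hull ?D i) = (\<Inter>i\<in>M. convex hull ?D i)"
    using M(2) by blast
  moreover have "polyhedron (convex hull ?D i)" if "i \<in> I" for i
  proof -
    have "convex hull ?D i = {x. 0 \<le> x} \<inter> {x. restrict_coords J x \<in> convex hull (F i)}"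
      using int restr \<open>i \<in> I\<close> by (intro convex_hull_cylinder) auto
    also have "polyhedron \<dots>"
      using fin \<open>i \<in> I\<close> by (intro polyhedron_Int polyhedron_nonneg
          polyhedron_restrict_coords_vimage polyhedron_convex_hull)
    finally show ?thesis .
  qed
  moreover have "polyhedron (\<Inter>i\<in>M. convex hull ?D i)"
    using M(1,2) calculation(2) by (intro polyhedron_Inter) auto
  ultimately show ?thesis
    by simp
qed

section \<open>Integer points of a packing system\<close>

lemma finite_nonneg_integer_vectors_le:
  "finite {x \<in> nonneg_integer_vectors. x \<le> u}"
proof (rule finite_subset)
  let ?B = "\<lambda>j. {k \<in> \<int>. 0 \<le> k \<and> k \<le> u $ j}"
  show "finite (vec_lambda ` (\<Pi>\<^sub>E j\<in>UNIV. ?B j))"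
    by (intro finite_imageI finite_PiE finite_int_segment) simp
  show "{x \<in> nonneg_integer_vectors. x \<le> u} \<subseteq> vec_lambda ` (\<Pi>\<^sub>E j\<in>UNIV. ?B j)"
  proof
    fix x assume "x \<in> {x \<in> nonneg_integer_vectors. x \<le> u}"
    then have "vec_nth x \<in> (\<Pi>\<^sub>E j\<in>UNIV. ?B j)"
      by (auto simp: nonneg_integer_vectors_def integer_vectors_def less_eq_vec_def)
    then show "x \<in> vec_lambda ` (\<Pi>\<^sub>E j\<in>UNIV. ?B j)"
      by (rule rev_image_eqI) simp
  qed
qed

text \<open>For nonnegative \<open>C\<close> the constraints bound these coordinates from above; the
  others do not occur in them.\<close>

definition nonzero_columns :: "real^'n^'k \<Rightarrow> 'n set" where
  "nonzero_columns C = {j. \<exists>l. C $ l $ j \<noteq> 0}"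

lemma matrix_vector_mult_restrict_nonzero_columns:
  "C *v restrict_coords (nonzero_columns C) x = C *v x"
  by (auto simp: vec_eq_iff matrix_vector_mult_def nonzero_columns_def intro!: sum.cong)

lemma matrix_vector_mult_mono:
  fixes C :: "real^'n^'k"
  assumes "\<And>l j. 0 \<le> C $ l $ j" "x \<le> y"
  shows "C *v x \<le> C *v y"
  using assms by (auto simp: less_eq_vec_def matrix_vector_mult_def intro!: sum_mono mult_left_mono)

text \<open>The base of the cylinder formed by the integer points, with the free coordinates pinned
  to 0.\<close>

definition packing_section :: "real^'n^'k \<Rightarrow> real^'k \<Rightarrow> (real^'n) set" where
  "packing_section C d = {x \<in> packing_polyhedron C d \<inter> integer_vectors.
     restrict_coords (nonzero_columns C) x = x}"

text \<open>Zeroing the free coordinates changes neither \<open>C *v x\<close> nor nonnegativity and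
  integrality of a vector in \<nat>^n, so they can be chosen independently.\<close>

lemma packing_integer_points_eq_cylinder:
  "packing_polyhedron C d \<inter> integer_vectors =
    {x \<in> nonneg_integer_vectors. restrict_coords (nonzero_columns C) x \<in> packing_section C d}"
proof -
  have "restrict_coords J x \<in> nonneg_integer_vectors" if "x \<in> nonneg_integer_vectors"
    for J and x :: "real^'a"
    using that by (simp add: nonneg_integer_vectors_iff)
  moreover have "restrict_coords J (restrict_coords J x) = restrict_coords J x"
    for J and x :: "real^'a"
    by (simp add: vec_eq_iff)
  ultimately show ?thesis
    by (auto simp: packing_section_def packing_polyhedron_def nonneg_integer_vectors_def
        matrix_vector_mult_restrict_nonzero_columns)
qed

lemma finite_packing_section:
  fixes C :: "real^'n^'k"
  assumes C: "\<And>l j. 0 \<le> C $ l $ j"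
  shows "finite (packing_section C d)"
proof -
  let ?J = "nonzero_columns C"
  have "\<forall>j\<in>?J. \<exists>l. C $ l $ j \<noteq> 0"
    by (simp add: nonzero_columns_def)
  then obtain l where l: "\<And>j. j \<in> ?J \<Longrightarrow> C $ l j $ j \<noteq> 0"
    using bchoice[of ?J "\<lambda>j l. C $ l $ j \<noteq> 0"] by blast
  \<comment> \<open>With nonnegative terms, row \<open>l j\<close> alone bounds coordinate
    \<open>j\<close>. The bound 0 suits the remaining coordinates, which vanish on the
    section.\<close>
  define u where "u = (\<chi> j. if j \<in> ?J then d $ l j / C $ l j $ j else 0)"
  have "x \<le> u" if x: "x \<in> packing_section C d" for x
    unfolding less_eq_vec_def
  proof
    fix j
    have nonneg: "0 \<le> x $ i" for i
      using x by (simp add: packing_section_def packing_polyhedron_def less_eq_vec_def)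
    show "x $ j \<le> u $ j"
    proof (cases "j \<in> ?J")
      case True
      have "C $ l j $ j * x $ j \<le> (\<Sum>i\<in>UNIV. C $ l j $ i * x $ i)"
        using C nonneg by (intro member_le_sum) auto
      also have "\<dots> \<le> d $ l j"
        using x by (simp add: packing_section_def packing_polyhedron_def less_eq_vec_def
            matrix_vector_mult_def)
      finally show ?thesis
        using True l[OF True] C[of "l j" j] by (simp add: u_def pos_le_divide_eq mult.commute)
    next
      case False
      have "restrict_coords ?J x $ j = x $ j"
        using x by (simp add: packing_section_def)
      with False show ?thesis
        by (simp add: u_def)
    qed
  qed
  then have "packing_section C d \<subseteq> {x \<in> nonneg_integer_vectors. x \<le> u}"
    by (auto simp: packing_section_def packing_polyhedron_def nonneg_integer_vectors_def)
  then show ?thesis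
    using finite_nonneg_integer_vectors_le finite_subset by blast
qed

text \<open>Multiplication by a nonnegative matrix is monotone, and the pinned coordinates are
  squeezed between 0 and 0.\<close>

lemma packing_section_downward_closed:
  fixes C :: "real^'n^'k"
  assumes "\<And>l j. 0 \<le> C $ l $ j" "y \<in> packing_section C d" "x \<in> nonneg_integer_vectors" "x \<le> y"
  shows "x \<in> packing_section C d"
proof -
  have "x $ j = 0" if "j \<notin> nonzero_columns C" for j
  proof -
    have "restrict_coords (nonzero_columns C) y $ j = y $ j"
      using assms(2) by (simp add: packing_section_def)
    with that have "y $ j = 0"
      by simp
    moreover have "0 \<le> x $ j" "x $ j \<le> y $ j"
      using assms(3,4) by (simp_all add: nonneg_integer_vectors_def less_eq_vec_def)
    ultimately show ?thesis
      by simp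
  qed
  moreover have "C *v x \<le> d"
    using matrix_vector_mult_mono[OF assms(1,4)] assms(2)
    by (auto simp: packing_section_def packing_polyhedron_def intro: order_trans)
  ultimately show ?thesis
    using assms(3)
    by (auto simp: packing_section_def packing_polyhedron_def nonneg_integer_vectors_def vec_eq_iff)
qed

section \<open>Intersections over families of packing systems and the aggregation closure\<close>

text \<open>The family, possibly infinite, is grouped by the set of nonzero columns, so that all
  cylinders in a group share their free directions and can be compared through their
  sections.\<close>

theorem polyhedron_Inter_convex_hull_packing:
  fixes C :: "'i \<Rightarrow> real^'n^'k" and d :: "'i \<Rightarrow> real^'k"
  assumes C: "\<And>i l j. i \<in> I \<Longrightarrow> 0 \<le> C i $ l $ j"
  shows "polyhedron (\<Inter>i\<in>I. convex hull (packing_polyhedron (C i) (d i) \<inter> integer_vectors))"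
proof -
  let ?H = "\<lambda>i. convex hull (packing_polyhedron (C i) (d i) \<inter> integer_vectors)"
  have "polyhedron (\<Inter>i\<in>{i \<in> I. nonzero_columns (C i) = J}. ?H i)" for J
  proof -
    let ?F = "\<lambda>i. packing_section (C i) (d i)"
    have "polyhedron (\<Inter>i\<in>{i \<in> I. nonzero_columns (C i) = J}.
      convex hull {x \<in> nonneg_integer_vectors. restrict_coords J x \<in> ?F i})"
    proof (rule polyhedron_Inter_convex_hull_cylinders)
      fix i assume i: "i \<in> {i \<in> I. nonzero_columns (C i) = J}"
      show "finite (?F i)"
        using i C by (intro finite_packing_section) simp
      show "?F i \<subseteq> nonneg_integer_vectors"
        by (auto simp: packing_section_def packing_polyhedron_def nonneg_integer_vectors_def)
      show "restrict_coords J x = x" if "x \<in> ?F i" for x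
        using i that by (auto simp: packing_section_def)
      show "x \<in> ?F i" if "y \<in> ?F i" "x \<in> nonneg_integer_vectors" "x \<le> y" for x y
        using i C that by (intro packing_section_downward_closed[of "C i" y "d i" x]) auto
    qed
    then show ?thesis
      by (simp add: packing_integer_points_eq_cylinder cong: INF_cong_simp)
  qed
  \<comment> \<open>A finite index type has finitely many subsets \<open>J\<close>, hence there are
    finitely many groups.\<close>
  then have "polyhedron (\<Inter>J\<in>UNIV. \<Inter>i\<in>{i \<in> I. nonzero_columns (C i) = J}. ?H i)"
    by (intro polyhedron_Inter) auto
  also have "(\<Inter>J\<in>UNIV. \<Inter>i\<in>{i \<in> I. nonzero_columns (C i) = J}. ?H i) = (\<Inter>i\<in>I. ?H i)"
    by auto
  finally show ?thesis .
qed

theorem theorem2: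
  fixes A :: "real^'n^'m" and b :: "real^'m"
  assumes "\<And>i j. A $ i $ j \<in> \<int>"
    and "\<And>i. b $ i \<in> \<int>"
    and "\<And>i j. 0 \<le> A $ i $ j"
    and "\<And>i. 0 < b $ i"
  shows "polyhedron (aggregation_closure TYPE('k::finite) A b)"
  unfolding aggregation_closure_def aggregated_polyhedron_def
\<comment> \<open>The multipliers themselves index the family; each aggregated matrix is a product
  of nonnegative matrices.\<close>
proof (rule polyhedron_Inter_convex_hull_packing)
  fix \<Lambda> :: "real^'k^'m" and l j
  assume "\<Lambda> \<in> {\<Lambda>. \<forall>i l. 0 \<le> \<Lambda> $ i $ l}"
  then show "0 \<le> (transpose \<Lambda> ** A) $ l $ j"
    using assms(3) by (auto simp: matrix_matrix_mult_def transpose_def intro!: sum_nonneg)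
qed

end
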